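(* Let $A$ be a finite alphabet with $\#(A)\ge 2$. Then the star-free languages over $A$ and the generalised definite languages over $A$ have the same measuring power, i.e. $\mathrm{Ext}(\mathsf{SF}_A)=\mathrm{Ext}(\mathsf{GD}_A)$: for every language $L\subseteq A^*$ (not necessarily regular), $L$ is $\mathsf{SF}_A$-measurable if and only if $L$ is $\mathsf{GD}_A$-measurable.
   Context: $\#(X)$ denotes the cardinality of a set $X$. For $L\subseteq A^*$, the density is $\delta_A(L)=\lim_{n\to\infty}\frac1n\sum_{k=0}^{n-1}\frac{\#(L\cap A^k)}{\#(A^k)}$ if the limit exists, otherwise $\delta_A(L)=\bot$ (undefined). (Every regular language has a density.) For a family $\mathcal C$ of languages over $A$ and $L\subseteq A^*$, put $\underline{\mu}_{\mathcal C}(L)=\sup\{\delta_A(K): K\subseteq L,\ K\in\mathcal C,\ \delta_A(K)\ne\bot\}$ and $\overline{\mu}_{\mathcal C}(L)=\inf\{\delta_A(K): L\subseteq K,\ K\in\mathcal C,\ \delta_A(K)\ne\bot\}$. $L$ is $\mathcal C$-measurable if $\underline{\mu}_{\mathcal C}(L)=\overline{\mu}_{\mathcal C}(L)$. $\mathrm{Ext}(\mathcal C)$ is the class of all $\mathcal C$-measurable languages over $A$. A monoid $M$ recognises $L\subseteq A^*$ if there are a monoid morphism $\eta:A^*\to M$ and $S\subseteq M$ with $L=\eta^{-1}(S)$. Green's relation $\mathcal H$ on $M$: $x\mathrel{\mathcal H}y$ iff $xM=yM$ and $Mx=My$; $M$ is $\mathcal H$-trivial if every $\mathcal H$-class is a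 singleton. $\mathsf{SF}_A$ (star-free languages) is the class of languages over $A$ recognised by a finite $\mathcal H$-trivial (equivalently, finite aperiodic) monoid. $\mathsf{GD}_A$ (generalised definite languages) is the Boolean closure (finite unions, finite intersections, complements in $A^*$) of $\{wA^*, A^*w : w\in A^*\}$. *)

theory Defs
  imports Complex_Main "HOL-Algebra.Coset"
begin

text \<open>
  The alphabet is a type \<open>'a\<close> of class \<open>finite\<close>, so words are lists over \<open>'a\<close> and the set
  of all words is \<open>UNIV\<close>.
\<close>

section \<open>Density and measurability\<close>

definition words_of_length :: "nat \<Rightarrow> 'a list set" where
  "words_of_length k = {w. length w = k}"

definition density_seq :: "'a::finite list set \<Rightarrow> nat \<Rightarrow> real" where
  "density_seq L n =
     (1 / real n) *
     (\<Sum>k<n. real (card (L \<inter> words_of_length k)) / real (card (words_of_length k :: 'a list set)))"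

text \<open>\<open>None\<close> stands for an undefined density.\<close>

definition lang_density :: "'a::finite list set \<Rightarrow> real option" where
  "lang_density L = (if convergent (density_seq L) then Some (lim (density_seq L)) else None)"

text \<open>
  The supremum and infimum are taken in the reals. Densities lie in the unit interval, and both
  sets are nonempty as soon as the family contains the empty and the full language; see
  \<open>lang_density_bounds\<close>, \<open>lang_density_empty\<close>, \<open>lang_density_UNIV\<close> and the membership
  lemmas for the two families below.
\<close>

definition lower_measure :: "'a::finite list set set \<Rightarrow> 'a list set \<Rightarrow> real" where
  "lower_measure \<C> L = Sup {d. \<exists>K\<in>\<C>. K \<subseteq> L \<and> lang_density K = Some d}"

definition upper_measure :: "'a::finite list set set \<Rightarrow> 'a list set \<Rightarrow> real" where
  "upper_measure \<C> L = Inf {d. \<exists>K\<in>\<C>. L \<subseteq> K \<and> lang_density K = Some d}"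

definition measurable_lang :: "'a::finite list set set \<Rightarrow> 'a list set \<Rightarrow> bool" where
  "measurable_lang \<C> L \<longleftrightarrow> lower_measure \<C> L = upper_measure \<C> L"

definition Ext :: "'a::finite list set set \<Rightarrow> 'a list set set" where
  "Ext \<C> = {L. measurable_lang \<C> L}"

section \<open>Star-free languages\<close>

definition green_H :: "('m, 'b) monoid_scheme \<Rightarrow> ('m \<times> 'm) set" where
  "green_H M = {(x, y). x \<in> carrier M \<and> y \<in> carrier M \<and>
     x <#\<^bsub>M\<^esub> carrier M = y <#\<^bsub>M\<^esub> carrier M \<and> carrier M #>\<^bsub>M\<^esub> x = carrier M #>\<^bsub>M\<^esub> y}"

definition H_trivial :: "('m, 'b) monoid_scheme \<Rightarrow> bool" where
  "H_trivial M \<longleftrightarrow> (\<forall>X \<in> carrier M // green_H M. is_singleton X)"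

definition free_monoid :: "'a list monoid" where
  "free_monoid = \<lparr>carrier = UNIV, mult = (@), one = []\<rparr>"

text \<open>\<open>hom\<close> only asks for multiplicativity, hence the separate condition on the unit.\<close>

definition recognises :: "('m, 'b) monoid_scheme \<Rightarrow> 'a list set \<Rightarrow> bool" where
  "recognises M L \<longleftrightarrow> (\<exists>\<eta> \<in> hom free_monoid M. \<eta> \<one>\<^bsub>free_monoid\<^esub> = \<one>\<^bsub>M\<^esub> \<and>
     (\<exists>S \<subseteq> carrier M. L = \<eta> -` S))"

text \<open>
  A type cannot be quantified inside a definition. Every finite monoid is isomorphic to one whose
  elements are natural numbers, so restricting to these loses nothing; see \<open>star_freeI\<close>.
\<close>

definition star_free :: "'a list set set" where
  "star_free = {L. \<exists>M :: nat monoid. monoid M \<and> finite (carrier M) \<and> H_trivial M \<and> recognises M L}"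

section \<open>Generalised definite languages\<close>

inductive_set gen_definite :: "'a list set set" where
  prefix: "range (\<lambda>u. w @ u) \<in> gen_definite"
| suffix: "range (\<lambda>u. u @ w) \<in> gen_definite"
| union: "K \<in> gen_definite \<Longrightarrow> L \<in> gen_definite \<Longrightarrow> K \<union> L \<in> gen_definite"
| inter: "K \<in> gen_definite \<Longrightarrow> L \<in> gen_definite \<Longrightarrow> K \<inter> L \<in> gen_definite"
| compl: "K \<in> gen_definite \<Longrightarrow> - K \<in> gen_definite"

section \<open>Adequacy of the definitions\<close>

lemma UNIV_in_gen_definite: "UNIV \<in> gen_definite"
  using gen_definite.prefix[of "[]"] by simp

lemma empty_in_gen_definite: "{} \<in> gen_definite"
  using gen_definite.compl[OF UNIV_in_gen_definite] by simp

lemma H_trivial_iff: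
  "H_trivial M \<longleftrightarrow> (\<forall>x y. (x, y) \<in> green_H M \<longrightarrow> x = y)"
proof
  assume H: "H_trivial M"
  show "\<forall>x y. (x, y) \<in> green_H M \<longrightarrow> x = y"
  proof (intro allI impI)
    fix x y assume xy: "(x, y) \<in> green_H M"
    then have x: "x \<in> carrier M" and xx: "(x, x) \<in> green_H M"
      by (auto simp: green_H_def)
    from x H have "is_singleton (green_H M `` {x})"
      by (auto simp: H_trivial_def intro: quotientI)
    then obtain z where "green_H M `` {x} = {z}" by (auto simp: is_singleton_def)
    with xy xx have "x = z" "y = z" by (simp_all add: set_eq_iff)
    then show "x = y" by simp
  qed
next
  assume H: "\<forall>x y. (x, y) \<in> green_H M \<longrightarrow> x = y"
  show "H_trivial M"
    unfolding H_trivial_def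
  proof
    fix X assume "X \<in> carrier M // green_H M"
    then obtain x where x: "x \<in> carrier M" "X = green_H M `` {x}" by (auto elim: quotientE)
    then have "X = {x}" using H by (auto simp: green_H_def)
    then show "is_singleton X" by simp
  qed
qed

lemma star_freeI:
  fixes M :: "('m, 'b) monoid_scheme"
  assumes M: "monoid M" and fin: "finite (carrier M)" and H: "H_trivial M"
    and rec: "recognises M L"
  shows "L \<in> star_free"
proof -
  interpret M: monoid M by (rule M)
  obtain f :: "'m \<Rightarrow> nat" where inj: "inj_on f (carrier M)"
    using fin finite_imp_inj_to_nat_seg by blast
  define g where "g = inv_into (carrier M) f"
  have gf[simp]: "g (f x) = x" if "x \<in> carrier M" for x
    using that inj by (simp add: g_def)
  define N :: "nat monoid" where
    "N = \<lparr>carrier = f ` carrier M, mult = (\<lambda>a b. f (g a \<otimes>\<^bsub>M\<^esub> g b)), one = f \<one>\<^bsub>M\<^esub>\<rparr>"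
  have N[simp]: "carrier N = f ` carrier M" "\<one>\<^bsub>N\<^esub> = f \<one>\<^bsub>M\<^esub>"
    "a \<otimes>\<^bsub>N\<^esub> b = f (g a \<otimes>\<^bsub>M\<^esub> g b)" for a b
    by (simp_all add: N_def)
  have "monoid N"
    by (rule monoidI) (auto simp: M.m_assoc)
  moreover have "finite (carrier N)" using fin by simp
  moreover have "H_trivial N"
    unfolding H_trivial_iff
  proof (intro allI impI)
    fix a b assume ab: "(a, b) \<in> green_H N"
    then obtain x y where xy: "x \<in> carrier M" "y \<in> carrier M" "a = f x" "b = f y"
      by (auto simp: green_H_def)
    have l: "f z <#\<^bsub>N\<^esub> carrier N = f ` (z <#\<^bsub>M\<^esub> carrier M)"
      and r: "carrier N #>\<^bsub>N\<^esub> f z = f ` (carrier M #>\<^bsub>M\<^esub> z)" if "z \<in> carrier M" for z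
      using that by (auto simp: l_coset_def r_coset_def)
    have sub: "z <#\<^bsub>M\<^esub> carrier M \<subseteq> carrier M" "carrier M #>\<^bsub>M\<^esub> z \<subseteq> carrier M"
      if "z \<in> carrier M" for z
      using that by (auto simp: l_coset_def r_coset_def)
    have "f ` (x <#\<^bsub>M\<^esub> carrier M) = f ` (y <#\<^bsub>M\<^esub> carrier M)"
      "f ` (carrier M #>\<^bsub>M\<^esub> x) = f ` (carrier M #>\<^bsub>M\<^esub> y)"
      using ab xy l r unfolding green_H_def by auto
    then have "(x, y) \<in> green_H M"
      using inj_on_image_eq_iff[OF inj] sub xy by (simp add: green_H_def)
    then have "x = y" using H unfolding H_trivial_iff by simp
    with xy show "a = b" by simp
  qed
  moreover have "recognises N L"
  proof -
    obtain \<eta> S where \<eta>: "\<eta> \<in> hom free_monoid M" "\<eta> \<one>\<^bsub>free_monoid\<^esub> = \<one>\<^bsub>M\<^esub>"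
      and S: "S \<subseteq> carrier M" "L = \<eta> -` S"
      using rec by (auto simp: recognises_def)
    have c: "\<eta> w \<in> carrier M" for w using \<eta>(1) by (auto simp: hom_def free_monoid_def)
    have "(\<lambda>w. f (\<eta> w)) \<in> hom free_monoid N"
      using \<eta>(1) c by (auto simp: hom_def free_monoid_def)
    moreover have "L = (\<lambda>w. f (\<eta> w)) -` (f ` S)"
      unfolding S(2) vimage_def using inj_on_image_mem_iff[OF inj c S(1)] by simp
    ultimately show ?thesis
      unfolding recognises_def using \<eta>(2) S(1)
      by (intro bexI[of _ "\<lambda>w. f (\<eta> w)"] conjI exI[of _ "f ` S"]) auto
  qed
  ultimately show ?thesis unfolding star_free_def by blast
qed

lemma trivial_in_star_free:
  "{} \<in> (star_free :: 'a list set set)" "UNIV \<in> (star_free :: 'a list set set)"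
proof -
  define M :: "unit monoid" where "M = \<lparr>carrier = UNIV, mult = (\<lambda>_ _. ()), one = ()\<rparr>"
  have "monoid M" "finite (carrier M)" "H_trivial M"
    by (auto simp: M_def H_trivial_iff intro!: monoidI)
  moreover have "recognises M L" if "L = {} \<or> L = UNIV" for L :: "'a list set"
    unfolding recognises_def
    by (rule bexI[of _ "\<lambda>_. ()"], use that in \<open>auto simp: M_def hom_def free_monoid_def\<close>)
  ultimately have "L \<in> star_free" if "L = {} \<or> L = UNIV" for L :: "'a list set"
    using that star_freeI by metis
  then show "{} \<in> (star_free :: 'a list set set)" "UNIV \<in> (star_free :: 'a list set set)"
    by simp_all
qed

lemma finite_words_of_length: "finite (words_of_length k :: 'a::finite list set)"
  using finite_lists_length_eq[of "UNIV :: 'a set" k] by (simp add: words_of_length_def)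

lemma card_words_of_length: "card (words_of_length k :: 'a::finite list set) = card (UNIV :: 'a set) ^ k"
  using card_lists_length_eq[of "UNIV :: 'a set" k] by (simp add: words_of_length_def)

lemma density_seq_bounds: "0 \<le> density_seq L n \<and> density_seq L n \<le> 1"
proof -
  let ?r = "\<lambda>k. real (card (L \<inter> words_of_length k)) / real (card (words_of_length k :: 'a list set))"
  have "0 \<le> ?r k \<and> ?r k \<le> 1" for k
    by (auto simp: divide_le_eq_1 intro!: card_mono finite_words_of_length)
  then have "0 \<le> (\<Sum>k<n. ?r k)" "(\<Sum>k<n. ?r k) \<le> (\<Sum>k<n. 1)"
    using sum_nonneg[of "{..<n}" ?r] sum_mono[of "{..<n}" ?r "\<lambda>_. 1"] by simp_all
  then show ?thesis by (auto simp: density_seq_def divide_le_eq_1)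
qed

lemma lang_density_bounds:
  assumes "lang_density L = Some d"
  shows "0 \<le> d \<and> d \<le> 1"
proof -
  have "density_seq L \<longlonglongrightarrow> d"
    using assms by (auto simp: lang_density_def convergent_LIMSEQ_iff split: if_splits)
  then show ?thesis
    using density_seq_bounds by (meson LIMSEQ_le_const LIMSEQ_le_const2)
qed

lemma lang_density_empty: "lang_density {} = Some 0"
proof -
  have "density_seq ({} :: 'a list set) \<longlonglongrightarrow> 0" by (simp add: density_seq_def[abs_def])
  then show ?thesis by (auto simp: lang_density_def convergent_def dest: limI)
qed

lemma lang_density_UNIV: "lang_density UNIV = Some 1"
proof -
  have "density_seq (UNIV :: 'a list set) n = 1" if "n \<ge> 1" for n
    using that by (simp add: density_seq_def card_words_of_length)
  then have "density_seq (UNIV :: 'a list set) \<longlonglongrightarrow> 1"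
    by (intro tendsto_eventually) (auto simp: eventually_sequentially)
  then show ?thesis by (auto simp: lang_density_def convergent_def dest: limI)
qed

end

theory Submission
  imports Defs "HOL-Library.Sublist"
begin

text \<open>
  Let \<open>\<eta> : A\<^sup>* \<rightarrow> M\<close> with \<open>M\<close> finite and \<open>\<H>\<close>-trivial, and let \<open>z\<close> be a word whose image lies in
  the minimal ideal of \<open>\<eta>(A\<^sup>*)\<close>. Then \<open>\<eta>(z x z)\<close> and \<open>\<eta>(z)\<close> are \<open>\<H>\<close>-equivalent, hence equal, for
  every \<open>x\<close>; so \<open>\<eta>\<close> is constant on \<open>u A\<^sup>* v\<close> as soon as \<open>z\<close> is a factor of both \<open>u\<close> and \<open>v\<close>.
  A star-free language \<open>K\<close> therefore contains the generalised definite union of those \<open>u A\<^sup>* v\<close> with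
  \<open>u, v\<close> of length \<open>n\<close> that meet it, and only misses words whose prefix or suffix of length \<open>n\<close>
  avoids \<open>z\<close>. The density of the latter tends to \<open>0\<close> as \<open>n\<close> grows.
\<close>

section \<open>Densities\<close>

lemma lang_density_eq_Some_iff: "lang_density L = Some d \<longleftrightarrow> density_seq L \<longlonglongrightarrow> d"
  by (auto simp: lang_density_def convergent_LIMSEQ_iff convergent_def dest: limI)

text \<open>A Cesaro limit ignores finitely many terms: the lengths below \<open>m\<close>
  contribute a fixed sum, which vanishes after division by \<open>n\<close>.\<close>

lemma density_seq_tendsto:
  fixes L :: "'a::finite list set"
  assumes L: "\<And>k. m \<le> k \<Longrightarrow>
    real (card (L \<inter> words_of_length k)) = d * real (card (words_of_length k :: 'a list set))"
  shows "density_seq L \<longlonglongrightarrow> d"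
proof -
  define r where
    "r k = real (card (L \<inter> words_of_length k)) / real (card (words_of_length k :: 'a list set))" for k
  define C where "C = (\<Sum>k<m. r k - d)"
  have r: "r k = d" if "m \<le> k" for k
    using L[OF that] by (simp add: r_def card_words_of_length)
  \<comment> \<open>Taking \<open>Suc m\<close> instead of \<open>m\<close> rules out
    \<open>n = 0\<close>, where \<open>density_seq\<close> is \<open>0\<close> because division by
    zero yields \<open>0\<close>.\<close>
  have "density_seq L n = C / real n + d" if "n \<ge> Suc m" for n
  proof -
    have "(\<Sum>k<n. r k - d) = C"
      unfolding C_def using that r by (intro sum.mono_neutral_right) auto
    then have "(\<Sum>k<n. r k) = C + real n * d" by (simp add: sum_subtractf)
    then show ?thesis using that by (simp add: density_seq_def r_def field_simps)
  qed
  then have "eventually (\<lambda>n. C / real n + d = density_seq L n) sequentially"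
    unfolding eventually_sequentially by (intro exI[of _ "Suc m"]) simp
  moreover have "(\<lambda>n. C / real n + d) \<longlonglongrightarrow> 0 + d"
    by (intro tendsto_add lim_const_over_n tendsto_const)
  ultimately show ?thesis using Lim_transform_eventually by fastforce
qed

lemma density_seq_mono:
  assumes "K \<subseteq> L"
  shows "density_seq K n \<le> density_seq L n"
  unfolding density_seq_def using assms
  by (intro mult_left_mono sum_mono divide_right_mono)
    (auto intro!: card_mono finite_words_of_length)

lemma density_seq_Un_le: "density_seq (K \<union> L) n \<le> density_seq K n + density_seq L n"
proof -
  have "real (card ((K \<union> L) \<inter> words_of_length k))
      \<le> real (card (K \<inter> words_of_length k)) + real (card (L \<inter> words_of_length k))" for k
    by (metis Int_Un_distrib2 card_Un_le of_nat_add of_nat_le_iff)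
  then show ?thesis
    unfolding density_seq_def distrib_left[symmetric] sum.distrib[symmetric]
      add_divide_distrib[symmetric]
    by (intro mult_left_mono sum_mono divide_right_mono) auto
qed

lemma lang_density_Compl:
  fixes L :: "'a::finite list set"
  assumes "lang_density L = Some d"
  shows "lang_density (- L) = Some (1 - d)"
proof -
  have c: "real (card (- L \<inter> words_of_length k))
      = real (card (words_of_length k :: 'a list set)) - real (card (L \<inter> words_of_length k))" for k
  proof -
    have "card (words_of_length k :: 'a list set)
        = card (L \<inter> words_of_length k) + card (- L \<inter> words_of_length k)"
      by (subst card_Un_disjoint[symmetric])
        (auto simp: finite_words_of_length intro: arg_cong[where f = card])
    then show ?thesis by simp
  qed
  have "density_seq (- L) n = 1 - density_seq L n" if "n \<ge> 1" for n
    using that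
    by (simp add: density_seq_def c card_words_of_length diff_divide_distrib sum_subtractf
        right_diff_distrib)
  then have "eventually (\<lambda>n. 1 - density_seq L n = density_seq (- L) n) sequentially"
    unfolding eventually_sequentially by (intro exI[of _ 1]) simp
  moreover have "(\<lambda>n. 1 - density_seq L n) \<longlonglongrightarrow> 1 - d"
    using assms by (intro tendsto_diff) (simp_all add: lang_density_eq_Some_iff)
  ultimately show ?thesis
    unfolding lang_density_eq_Some_iff by (rule Lim_transform_eventually[rotated])
qed

section \<open>Generalised definite languages are star-free\<close>

lemma recognises_iff:
  "recognises M L \<longleftrightarrow> (\<exists>\<eta> S. (\<forall>w. \<eta> w \<in> carrier M) \<and> (\<forall>u v. \<eta> (u @ v) = \<eta> u \<otimes>\<^bsub>M\<^esub> \<eta> v) \<and>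
     \<eta> [] = \<one>\<^bsub>M\<^esub> \<and> S \<subseteq> carrier M \<and> L = \<eta> -` S)"
  unfolding recognises_def hom_def free_monoid_def by auto

text \<open>The recognising monoid consists of the words of length at most \<open>n\<close>,
  multiplied by concatenating and keeping the first \<open>n\<close> letters; the morphism is
  \<open>take n\<close>. Equal right ideals make two elements prefixes of each other, whence
  \<open>H_trivial M\<close>.\<close>

lemma star_free_prefix: "range (\<lambda>u. w @ u) \<in> (star_free :: 'a::finite list set set)"
proof -
  define n where "n = length w"
  define M :: "'a list monoid" where "M = \<lparr>carrier = {u. length u \<le> n}, mult = (\<lambda>u v. take n (u @ v)), one = []\<rparr>"
  have [simp]: "carrier M = {u. length u \<le> n}" "\<one>\<^bsub>M\<^esub> = []" "u \<otimes>\<^bsub>M\<^esub> v = take n (u @ v)" for u v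
    by (simp_all add: M_def)
  have M: "monoid M"
    by (rule monoidI) (auto simp: min_def)
  have "H_trivial M"
    unfolding H_trivial_iff
  proof (intro allI impI)
    fix u v assume "(u, v) \<in> green_H M"
    then have len: "length u \<le> n" "length v \<le> n"
      and eq: "u <#\<^bsub>M\<^esub> carrier M = v <#\<^bsub>M\<^esub> carrier M"
      by (auto simp: green_H_def)
    have "u \<in> u <#\<^bsub>M\<^esub> carrier M" "v \<in> v <#\<^bsub>M\<^esub> carrier M"
      using len by (auto simp: l_coset_def intro!: exI[of _ "[]"])
    then have "u \<in> v <#\<^bsub>M\<^esub> carrier M" "v \<in> u <#\<^bsub>M\<^esub> carrier M"
      by (simp_all only: eq)
    then obtain x y where "u = take n (v @ x)" "v = take n (u @ y)"
      by (auto simp: l_coset_def simp del: take_append)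
    then have "prefix v u" "prefix u v"
      using len by (metis append_eq_conv_conj prefixI take_all_iff take_append)+
    then show "u = v" by (rule prefix_order.antisym[rotated])
  qed
  moreover have "finite (carrier M)"
    using finite_lists_length_le[of "UNIV :: 'a set" n] by simp
  moreover have "recognises M (range (\<lambda>u. w @ u))"
    unfolding recognises_iff
  proof (intro exI conjI)
    show "range (\<lambda>u. w @ u) = take n -` {w}"
      by (auto simp: n_def) (metis append_take_drop_id rangeI)
  qed (auto simp: n_def min_def)
  ultimately show ?thesis using M star_freeI by blast
qed

text \<open>Precomposing a morphism with \<open>rev\<close> gives a morphism into the opposite
  monoid. Its relation \<open>green_H\<close> is the same, since left and right ideals merely change
  places.\<close>

lemma star_free_rev:
  assumes "L \<in> star_free"
  shows "rev -` L \<in> star_free"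
proof -
  from assms obtain M :: "nat monoid" where M: "monoid M" "finite (carrier M)" "H_trivial M"
    and rec: "recognises M L" by (auto simp: star_free_def)
  interpret monoid M by (rule M(1))
  define N where "N = M\<lparr>mult := \<lambda>x y. y \<otimes>\<^bsub>M\<^esub> x\<rparr>"
  have [simp]: "carrier N = carrier M" "\<one>\<^bsub>N\<^esub> = \<one>\<^bsub>M\<^esub>" "x \<otimes>\<^bsub>N\<^esub> y = y \<otimes>\<^bsub>M\<^esub> x" for x y
    by (simp_all add: N_def)
  have "monoid N" by (rule monoidI) (auto simp: m_assoc)
  moreover have "green_H N = green_H M"
    by (auto simp: green_H_def l_coset_def r_coset_def)
  then have "H_trivial N" using M(3) by (simp add: H_trivial_def)
  moreover obtain \<eta> S where "\<forall>w. \<eta> w \<in> carrier M" "\<forall>u v. \<eta> (u @ v) = \<eta> u \<otimes>\<^bsub>M\<^esub> \<eta> v"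
    "\<eta> [] = \<one>\<^bsub>M\<^esub>" "S \<subseteq> carrier M" "L = \<eta> -` S"
    using rec unfolding recognises_iff by blast
  then have "recognises N (rev -` L)"
    unfolding recognises_iff by (intro exI[of _ "\<eta> \<circ> rev"] exI[of _ S]) auto
  ultimately show ?thesis using M(2) star_freeI[of N] by simp
qed

lemma star_free_suffix: "range (\<lambda>u. u @ w) \<in> (star_free :: 'a::finite list set set)"
proof -
  have "range (\<lambda>u. u @ w) = rev -` range (\<lambda>u. rev w @ u)"
    by (auto simp: image_iff) (metis rev_append rev_rev_ident)
  then show ?thesis using star_free_rev[OF star_free_prefix] by simp
qed

lemma star_free_Compl:
  assumes "L \<in> star_free"
  shows "- L \<in> star_free"
proof -
  have "recognises M (- L)" if rec: "recognises M L" for M :: "nat monoid"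
  proof -
    obtain \<eta> S where "\<forall>w. \<eta> w \<in> carrier M" "\<forall>u v. \<eta> (u @ v) = \<eta> u \<otimes>\<^bsub>M\<^esub> \<eta> v"
      "\<eta> [] = \<one>\<^bsub>M\<^esub>" "S \<subseteq> carrier M" "L = \<eta> -` S"
      using rec unfolding recognises_iff by blast
    then show ?thesis
      unfolding recognises_iff by (intro exI[of _ \<eta>] exI[of _ "carrier M - S"]) auto
  qed
  with assms show ?thesis unfolding star_free_def by blast
qed

text \<open>The direct product recognises the intersection. It is again \<open>H_trivial\<close>
  because its principal one-sided ideals are products of those of the factors.\<close>

lemma star_free_Int:
  assumes "K \<in> star_free" "L \<in> star_free"
  shows "K \<inter> L \<in> star_free"
proof -
  from assms obtain M N :: "nat monoid"
    where M: "monoid M" "finite (carrier M)" "H_trivial M" "recognises M K"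
      and N: "monoid N" "finite (carrier N)" "H_trivial N" "recognises N L"
    by (auto simp: star_free_def)
  interpret M: monoid M by (rule M(1))
  interpret N: monoid N by (rule N(1))
  define P where "P = \<lparr>carrier = carrier M \<times> carrier N,
    mult = (\<lambda>x y. (fst x \<otimes>\<^bsub>M\<^esub> fst y, snd x \<otimes>\<^bsub>N\<^esub> snd y)), one = (\<one>\<^bsub>M\<^esub>, \<one>\<^bsub>N\<^esub>)\<rparr>"
  have [simp]: "carrier P = carrier M \<times> carrier N" "\<one>\<^bsub>P\<^esub> = (\<one>\<^bsub>M\<^esub>, \<one>\<^bsub>N\<^esub>)"
    "x \<otimes>\<^bsub>P\<^esub> y = (fst x \<otimes>\<^bsub>M\<^esub> fst y, snd x \<otimes>\<^bsub>N\<^esub> snd y)" for x y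
    by (simp_all add: P_def)
  have "monoid P" by (rule monoidI) (auto simp: M.m_assoc N.m_assoc)
  moreover have "H_trivial P"
    unfolding H_trivial_iff
  proof (intro allI impI)
    fix x y assume xy: "(x, y) \<in> green_H P"
    have l: "x <#\<^bsub>P\<^esub> (carrier M \<times> carrier N) = (fst x <#\<^bsub>M\<^esub> carrier M) \<times> (snd x <#\<^bsub>N\<^esub> carrier N)" for x
      by (auto simp: l_coset_def)
    have r: "(carrier M \<times> carrier N) #>\<^bsub>P\<^esub> x = (carrier M #>\<^bsub>M\<^esub> fst x) \<times> (carrier N #>\<^bsub>N\<^esub> snd x)" for x
      by (auto simp: r_coset_def)
    \<comment> \<open>An equation between cartesian products splits into its components only when
      the factors are nonempty.\<close>
    have ne: "a <#\<^bsub>M\<^esub> carrier M \<noteq> {}" "carrier M #>\<^bsub>M\<^esub> a \<noteq> {}"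
      "b <#\<^bsub>N\<^esub> carrier N \<noteq> {}" "carrier N #>\<^bsub>N\<^esub> b \<noteq> {}" for a b
      using M.one_closed N.one_closed by (auto simp: l_coset_def r_coset_def)
    have "(fst x, fst y) \<in> green_H M" "(snd x, snd y) \<in> green_H N"
      using xy by (auto simp: green_H_def l r times_eq_iff ne)
    then show "x = y"
      using M(3) N(3) by (auto simp: H_trivial_iff intro: prod_eqI)
  qed
  moreover have "recognises P (K \<inter> L)"
  proof -
    obtain \<eta> S where \<eta>: "\<forall>w. \<eta> w \<in> carrier M" "\<forall>u v. \<eta> (u @ v) = \<eta> u \<otimes>\<^bsub>M\<^esub> \<eta> v"
      "\<eta> [] = \<one>\<^bsub>M\<^esub>" "S \<subseteq> carrier M" "K = \<eta> -` S"
      using M(4) unfolding recognises_iff by blast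
    obtain \<theta> T where \<theta>: "\<forall>w. \<theta> w \<in> carrier N" "\<forall>u v. \<theta> (u @ v) = \<theta> u \<otimes>\<^bsub>N\<^esub> \<theta> v"
      "\<theta> [] = \<one>\<^bsub>N\<^esub>" "T \<subseteq> carrier N" "L = \<theta> -` T"
      using N(4) unfolding recognises_iff by blast
    show ?thesis
      unfolding recognises_iff using \<eta> \<theta>
      by (intro exI[of _ "\<lambda>w. (\<eta> w, \<theta> w)"] exI[of _ "S \<times> T"]) auto
  qed
  ultimately show ?thesis using M(2) N(2) star_freeI[of P] by simp
qed

lemma gen_definite_subset_star_free: "gen_definite \<subseteq> (star_free :: 'a::finite list set set)"
proof
  fix L :: "'a list set" assume "L \<in> gen_definite"
  then show "L \<in> star_free"
  proof induction
    case (union K L)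
    \<comment> \<open>De Morgan reduces union to complement and intersection.\<close>
    then have "- (- K \<inter> - L) \<in> star_free" by (intro star_free_Compl star_free_Int)
    then show ?case by simp
  qed (auto intro: star_free_prefix star_free_suffix star_free_Compl star_free_Int)
qed

section \<open>Words with prescribed prefix and suffix\<close>

lemma gen_definite_UN:
  assumes "finite I" "\<And>i. i \<in> I \<Longrightarrow> F i \<in> gen_definite"
  shows "(\<Union>i\<in>I. F i) \<in> gen_definite"
  using assms
  by (induction I rule: finite_induct) (auto intro: empty_in_gen_definite gen_definite.union)

text \<open>The prefix and the suffix may touch but not overlap. For fixed lengths of
  \<open>u\<close> and \<open>v\<close> a word therefore splits in exactly one way, which makes the
  words countable by pairs.\<close>

definition frame_lang :: "('a list \<times> 'a list) set \<Rightarrow> 'a list set" where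
  "frame_lang P = (\<Union>(u, v)\<in>P. range (\<lambda>x. u @ x @ v))"

text \<open>Having prefix \<open>u\<close> and suffix \<open>v\<close> differs from being of the
  form \<open>u @ x @ v\<close> only on words short enough for the two to overlap. A lower bound on
  the length is itself generalised definite: it is a finite union of prefix languages.\<close>

lemma gen_definite_frame_lang:
  fixes P :: "('a::finite list \<times> 'a list) set"
  assumes "finite P"
  shows "frame_lang P \<in> gen_definite"
proof -
  have "range (\<lambda>x. u @ x @ v) = range (\<lambda>x. u @ x) \<inter> range (\<lambda>x. x @ v)
      \<inter> (\<Union>w\<in>words_of_length (length u + length v). range (\<lambda>x. w @ x))" (is "?L = ?R")
    for u v :: "'a list"
  proof (intro equalityI subsetI)
    fix w assume "w \<in> ?L"
    then obtain x where x: "w = u @ x @ v" by blast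
    have "w = take (length u + length v) w @ drop (length u + length v) w" by simp
    moreover have "take (length u + length v) w \<in> words_of_length (length u + length v)"
      by (simp add: x words_of_length_def)
    ultimately have "w \<in> (\<Union>w\<in>words_of_length (length u + length v). range (\<lambda>x. w @ x))"
      by blast
    moreover have "w \<in> range (\<lambda>x. u @ x)" "w \<in> range (\<lambda>x. x @ v)"
      using x by (auto simp: image_iff intro: exI[of _ "u @ x"])
    ultimately show "w \<in> ?R" by blast
  next
    fix w assume "w \<in> ?R"
    then obtain x y w' t where x: "w = u @ x" and y: "w = y @ v"
      and "w = w' @ t" "length w' = length u + length v"
      unfolding words_of_length_def by blast
    then have "length u + length v \<le> length w"
      by (metis length_append le_add1)
    then have "length u \<le> length y" using y by simp
    moreover have "y @ v = u @ x" using x y by simp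
    ultimately obtain t where "y = u @ t"
      by (auto simp: append_eq_append_conv2)
    then show "w \<in> ?L" using y by simp
  qed
  moreover have "(\<Union>w\<in>words_of_length n. range (\<lambda>x. w @ x)) \<in> (gen_definite :: 'a list set set)"
    for n
    by (intro gen_definite_UN gen_definite.prefix finite_words_of_length)
  ultimately have "range (\<lambda>x. u @ x @ v) \<in> gen_definite" for u v :: "'a list"
    using gen_definite.intros by metis
  then show ?thesis
    unfolding frame_lang_def by (intro gen_definite_UN assms) auto
qed

text \<open>From length \<open>2 * n\<close> on, each pair in \<open>P\<close> accounts for one word
  per choice of the middle part, and different choices give different words. The proportion is thus
  constant, not merely convergent.\<close>

lemma lang_density_frame_lang:
  fixes P :: "('a::finite list \<times> 'a list) set"
  assumes P: "P \<subseteq> words_of_length n \<times> words_of_length n"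
  shows "lang_density (frame_lang P) = Some (real (card P) / real (card (UNIV :: 'a set)) ^ (2 * n))"
  unfolding lang_density_eq_Some_iff
proof (rule density_seq_tendsto)
  fix k assume k: "2 * n \<le> k"
  define f where "f = (\<lambda>((u, v), x). u @ x @ v :: 'a list)"
  have "inj_on f (P \<times> words_of_length (k - 2 * n))"
    using P by (auto simp: inj_on_def f_def words_of_length_def subset_iff)
  moreover have "frame_lang P \<inter> words_of_length k = f ` (P \<times> words_of_length (k - 2 * n))"
  proof (intro equalityI subsetI)
    fix w assume "w \<in> frame_lang P \<inter> words_of_length k"
    then obtain u v x where "(u, v) \<in> P" "w = u @ x @ v" "length w = k"
      by (auto simp: frame_lang_def words_of_length_def)
    moreover from this have "x \<in> words_of_length (k - 2 * n)"
      using P by (auto simp: words_of_length_def)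
    ultimately show "w \<in> f ` (P \<times> words_of_length (k - 2 * n))"
      by (intro image_eqI[of _ _ "((u, v), x)"]) (auto simp: f_def)
  next
    fix w assume "w \<in> f ` (P \<times> words_of_length (k - 2 * n))"
    then obtain u v x where "(u, v) \<in> P" "length x = k - 2 * n" "w = u @ x @ v"
      by (auto simp: f_def words_of_length_def)
    then show "w \<in> frame_lang P \<inter> words_of_length k"
      using P k by (auto simp: frame_lang_def words_of_length_def)
  qed
  ultimately have "card (frame_lang P \<inter> words_of_length k)
      = card P * card (UNIV :: 'a set) ^ (k - 2 * n)"
    by (simp add: card_image card_cartesian_product card_words_of_length)
  then show "real (card (frame_lang P \<inter> words_of_length k))
      = real (card P) / real (card (UNIV :: 'a set)) ^ (2 * n)
        * real (card (words_of_length k :: 'a list set))"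
    using k by (simp add: card_words_of_length power_diff[of "real (card (UNIV :: 'a set))"])
qed

section \<open>Words avoiding a factor\<close>

definition avoiding :: "'a list \<Rightarrow> nat \<Rightarrow> 'a list set" where
  "avoiding z n = {w \<in> words_of_length n. \<not> sublist z w}"

lemma finite_avoiding: "finite (avoiding (z :: 'a::finite list) n)"
  by (rule finite_subset[OF _ finite_words_of_length[of n]]) (auto simp: avoiding_def)

text \<open>Cut the word into \<open>q\<close> blocks of length \<open>length z\<close>: no block
  can equal \<open>z\<close>. Occurrences of \<open>z\<close> across block borders are ignored, so
  this is only an upper bound.\<close>

lemma card_avoiding_le:
  fixes z :: "'a::finite list"
  shows "card (avoiding z (q * length z)) \<le> (card (UNIV :: 'a set) ^ length z - 1) ^ q"
proof (induction q)
  case 0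
  have "avoiding z 0 \<subseteq> {[]}" by (auto simp: avoiding_def words_of_length_def)
  from card_mono[OF _ this] show ?case by simp
next
  case (Suc q)
  let ?W = "(words_of_length (length z) - {z}) \<times> avoiding z (q * length z)"
  have "avoiding z (Suc q * length z) \<subseteq> (\<lambda>(x, y). x @ y) ` ?W"
  proof
    fix w assume w: "w \<in> avoiding z (Suc q * length z)"
    define x y where "x = take (length z) w" and "y = drop (length z) w"
    have "w = x @ y" by (simp add: x_def y_def)
    moreover from this have "x \<noteq> z" "\<not> sublist z y"
      using w by (auto simp: avoiding_def sublist_append)
    ultimately show "w \<in> (\<lambda>(x, y). x @ y) ` ?W"
      using w
      by (intro image_eqI[of _ _ "(x, y)"]) (auto simp: avoiding_def words_of_length_def x_def y_def)
  qed
  then have "card (avoiding z (Suc q * length z)) \<le> card ?W"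
    by (rule surj_card_le[rotated]) (simp add: finite_avoiding finite_words_of_length)
  also have "\<dots> = (card (UNIV :: 'a set) ^ length z - 1) * card (avoiding z (q * length z))"
    by (simp add: card_cartesian_product card_words_of_length finite_words_of_length words_of_length_def[of "length z"]
        flip: card_words_of_length)
  finally show ?case using Suc.IH by (simp add: order_trans)
qed

text \<open>For \<open>n = q * length z\<close> the block bound makes the fraction at most
  \<open>((C - 1) / C) ^ q\<close>, where \<open>C\<close> counts the words of length
  \<open>length z\<close>; this is a power of a number below \<open>1\<close>.\<close>

lemma avoiding_fraction_small:
  fixes z :: "'a::finite list"
  assumes "e > 0"
  obtains n where "real (card (avoiding z n)) / real (card (UNIV :: 'a set)) ^ n < e"
proof -
  define C where "C = real (card (UNIV :: 'a set)) ^ length z"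
  \<comment> \<open>The block bound subtracts in the natural numbers; \<open>pos\<close> is what
    lets that subtraction pass to the reals.\<close>
  have pos: "1 \<le> card (UNIV :: 'a set) ^ length z"
    by (rule one_le_power) (simp add: Suc_le_eq card_gt_0_iff)
  then have C: "C \<ge> 1" unfolding C_def by (metis of_nat_1 of_nat_le_iff of_nat_power)
  then obtain q where q: "((C - 1) / C) ^ q < e"
    using real_arch_pow_inv[OF assms, of "(C - 1) / C"] by auto
  have "real (card (avoiding z (q * length z)))
      \<le> real ((card (UNIV :: 'a set) ^ length z - 1) ^ q)"
    by (rule of_nat_mono) (rule card_avoiding_le)
  also have "\<dots> = (C - 1) ^ q"
    unfolding C_def of_nat_power of_nat_diff[OF pos] by simp
  finally have "real (card (avoiding z (q * length z))) / C ^ q \<le> (C - 1) ^ q / C ^ q"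
    by (rule divide_right_mono) (use C in simp)
  also have "\<dots> < e" using q by (simp only: power_divide)
  also have "C ^ q = real (card (UNIV :: 'a set)) ^ (q * length z)"
    unfolding C_def by (simp only: power_mult[symmetric] mult.commute)
  finally show ?thesis by (rule that)
qed

section \<open>Inner approximation of star-free languages\<close>

text \<open>Least cardinality replaces the minimal ideal: extending \<open>u\<close> to the right
  can only shrink \<open>R u\<close>, and extending \<open>v\<close> to the left can only shrink
  \<open>L v\<close>, so sets of least size stay fixed under extension.\<close>

lemma sandwich_word:
  fixes \<eta> :: "'a list \<Rightarrow> 'm"
  assumes M: "monoid M" "finite (carrier M)" "H_trivial M"
    and closed: "\<And>w. \<eta> w \<in> carrier M" and mult: "\<And>u v. \<eta> (u @ v) = \<eta> u \<otimes>\<^bsub>M\<^esub> \<eta> v"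
  obtains z where "\<And>x. \<eta> (z @ x @ z) = \<eta> z"
proof -
  interpret monoid M by (rule M(1))
  \<comment> \<open>\<open>R u\<close> and \<open>L u\<close> are the principal right and left
    ideals of \<open>\<eta> u\<close> inside the image of \<open>\<eta>\<close>.\<close>
  define R where "R u = range (\<lambda>x. \<eta> (u @ x))" for u
  define L where "L u = range (\<lambda>x. \<eta> (x @ u))" for u
  have fin: "finite (R u)" "finite (L u)" for u
    using closed by (auto simp: R_def L_def intro!: finite_subset[OF _ M(2)])
  obtain u where u: "\<And>y. card (R u) \<le> card (R y)"
    using ex_has_least_nat[of "\<lambda>_. True" "[]" "\<lambda>u. card (R u)"] by auto
  obtain v where v: "\<And>y. card (L v) \<le> card (L y)"
    using ex_has_least_nat[of "\<lambda>_. True" "[]" "\<lambda>u. card (L u)"] by auto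
  \<comment> \<open>Every \<open>z @ y\<close> extends \<open>u\<close> to the right and every
    \<open>y @ z\<close> extends \<open>v\<close> to the left, so \<open>z\<close> inherits both
    minimality properties.\<close>
  define z where "z = u @ v"
  have R: "R (z @ y) = R u" for y
    by (rule card_seteq[OF fin(1) _ u]) (auto simp: R_def z_def)
  have L: "L (y @ z) = L v" for y
  proof (rule card_seteq[OF fin(2) _ v])
    show "L (y @ z) \<subseteq> L v"
      by (auto simp: L_def z_def) (metis append.assoc rangeI)
  qed
  have "\<eta> (z @ x @ z) = \<eta> z" for x
  proof -
    let ?y = "z @ x @ z"
    have "\<eta> z \<in> R z" "\<eta> z \<in> L z"
      by (auto simp: R_def L_def image_iff intro: exI[of _ "[]"])
    then have "\<eta> z \<in> R ?y" "\<eta> z \<in> L ?y"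
      using R[of "[]"] R[of "x @ z"] L[of "[]"] L[of "z @ x"] by simp_all
    then obtain s t where "\<eta> z = \<eta> (?y @ s)" "\<eta> z = \<eta> (t @ ?y)"
      unfolding R_def L_def by blast
    then have s: "\<eta> z = \<eta> ?y \<otimes>\<^bsub>M\<^esub> \<eta> s" and t: "\<eta> z = \<eta> t \<otimes>\<^bsub>M\<^esub> \<eta> ?y"
      unfolding mult[of ?y] mult[of t] .
    have y: "\<eta> ?y = \<eta> z \<otimes>\<^bsub>M\<^esub> \<eta> (x @ z)" "\<eta> ?y = \<eta> (z @ x) \<otimes>\<^bsub>M\<^esub> \<eta> z"
      by (simp_all add: mult closed m_assoc)
    \<comment> \<open>Green's relation refers to the ideals of all of \<open>M\<close>, not of the
      image of \<open>\<eta>\<close>. The factorisations \<open>s\<close>, \<open>t\<close> and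
      \<open>y\<close> carry over and give the inclusions there.\<close>
    have l: "(a \<otimes>\<^bsub>M\<^esub> b) <#\<^bsub>M\<^esub> carrier M \<subseteq> a <#\<^bsub>M\<^esub> carrier M"
      and r: "carrier M #>\<^bsub>M\<^esub> (a \<otimes>\<^bsub>M\<^esub> b) \<subseteq> carrier M #>\<^bsub>M\<^esub> b"
      if "a \<in> carrier M" "b \<in> carrier M" for a b
      using that by (auto simp: l_coset_def r_coset_def m_assoc)
    have "\<eta> ?y <#\<^bsub>M\<^esub> carrier M = \<eta> z <#\<^bsub>M\<^esub> carrier M"
    proof
      show "\<eta> ?y <#\<^bsub>M\<^esub> carrier M \<subseteq> \<eta> z <#\<^bsub>M\<^esub> carrier M"
        unfolding y(1) by (rule l[OF closed closed])
      show "\<eta> z <#\<^bsub>M\<^esub> carrier M \<subseteq> \<eta> ?y <#\<^bsub>M\<^esub> carrier M"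
        by (subst s) (rule l[OF closed closed])
    qed
    moreover have "carrier M #>\<^bsub>M\<^esub> \<eta> ?y = carrier M #>\<^bsub>M\<^esub> \<eta> z"
    proof
      show "carrier M #>\<^bsub>M\<^esub> \<eta> ?y \<subseteq> carrier M #>\<^bsub>M\<^esub> \<eta> z"
        unfolding y(2) by (rule r[OF closed closed])
      show "carrier M #>\<^bsub>M\<^esub> \<eta> z \<subseteq> carrier M #>\<^bsub>M\<^esub> \<eta> ?y"
        by (subst t) (rule r[OF closed closed])
    qed
    ultimately have "(\<eta> ?y, \<eta> z) \<in> green_H M"
      using closed by (simp add: green_H_def)
    then show ?thesis using M(3) by (simp add: H_trivial_iff)
  qed
  then show ?thesis by (rule that)
qed

text \<open>With \<open>u = p @ z @ q\<close> and \<open>v = r @ z @ s\<close>, the factor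
  \<open>z @ (q @ x @ r) @ z\<close> has the same image as \<open>z\<close>, so the image of the
  whole word does not depend on \<open>x\<close>. One \<open>z\<close> serves all frames.\<close>

lemma star_free_frame_constant:
  assumes "K \<in> star_free"
  obtains z where
    "\<And>u v x y. \<lbrakk>sublist z u; sublist z v; u @ x @ v \<in> K\<rbrakk> \<Longrightarrow> u @ y @ v \<in> K"
proof -
  obtain M :: "nat monoid" where M: "monoid M" "finite (carrier M)" "H_trivial M"
    and "recognises M K" using assms by (auto simp: star_free_def)
  then obtain \<eta> S where closed: "\<And>w. \<eta> w \<in> carrier M"
    and mult: "\<And>u v. \<eta> (u @ v) = \<eta> u \<otimes>\<^bsub>M\<^esub> \<eta> v" and K: "K = \<eta> -` S"
    unfolding recognises_iff by blast
  obtain z where z: "\<And>x. \<eta> (z @ x @ z) = \<eta> z"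
    using sandwich_word[OF M closed mult] by blast
  interpret monoid M by (rule M(1))
  have const: "\<eta> ((p @ z @ q) @ x @ (r @ z @ s)) = \<eta> (p @ z @ s)" for p q r s x
  proof -
    have "\<eta> (p @ (z @ (q @ x @ r) @ z) @ s) = \<eta> (p @ z @ s)"
      using z[of "q @ x @ r"] by (simp only: mult)
    then show ?thesis by simp
  qed
  show ?thesis
  proof (rule that)
    fix u v x y assume "sublist z u" "sublist z v" "u @ x @ v \<in> K"
    then show "u @ y @ v \<in> K"
      unfolding sublist_def K vimage_eq using const by metis
  qed
qed

lemma star_free_inner_approx:
  fixes K :: "'a::finite list set"
  assumes K: "K \<in> star_free" and d: "lang_density K = Some d" and e: "e > 0"
  shows "\<exists>K'\<in>gen_definite. K' \<subseteq> K \<and> (\<exists>d'. lang_density K' = Some d' \<and> d - e \<le> d')"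
proof -
  obtain z where z: "\<And>u v x y. \<lbrakk>sublist z u; sublist z v; u @ x @ v \<in> K\<rbrakk> \<Longrightarrow> u @ y @ v \<in> K"
    using star_free_frame_constant[OF K] by blast
  \<comment> \<open>The bound is \<open>e / 2\<close> because \<open>z\<close> may be missing from
    either of the two ends.\<close>
  obtain n where n: "real (card (avoiding z n)) / real (card (UNIV :: 'a set)) ^ n < e / 2"
    using avoiding_fraction_small[of "e / 2" z] e by auto
  define W where "W = (words_of_length n :: 'a list set)"
  define c where "c = real (card (UNIV :: 'a set))"
  have c: "c > 0" by (simp add: c_def card_gt_0_iff)
  have W: "finite W" "real (card W) = c ^ n"
    by (simp_all add: W_def c_def finite_words_of_length card_words_of_length)
  \<comment> \<open>A single word of \<open>K\<close> in a frame of \<open>P\<close> suffices: by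
    the choice of \<open>z\<close>, the whole frame then lies in \<open>K\<close>.\<close>
  define P where "P = {(u, v) \<in> W \<times> W. sublist z u \<and> sublist z v \<and> (\<exists>x. u @ x @ v \<in> K)}"
  define Q where "Q = avoiding z n \<times> W \<union> W \<times> avoiding z n"
  have sub: "P \<subseteq> W \<times> W" "Q \<subseteq> W \<times> W" by (auto simp: P_def Q_def W_def avoiding_def)
  have "real (card Q) \<le> 2 * (real (card (avoiding z n)) * c ^ n)"
  proof -
    have "card Q \<le> card (avoiding z n \<times> W) + card (W \<times> avoiding z n)"
      unfolding Q_def by (rule card_Un_le)
    then have "real (card Q) \<le> real (2 * (card (avoiding z n) * card W))"
      by (subst of_nat_le_iff) (simp add: card_cartesian_product mult.commute)
    then show ?thesis by (simp add: W)
  qed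
  then have "real (card Q) / c ^ (2 * n) \<le> 2 * (real (card (avoiding z n)) * c ^ n) / c ^ (2 * n)"
    using c by (intro divide_right_mono) auto
  also have "\<dots> = 2 * (real (card (avoiding z n)) / c ^ n)"
    using c by (simp add: power_even_eq power2_eq_square)
  also have "\<dots> \<le> e" using n unfolding c_def by linarith
  finally have Qe: "real (card Q) / c ^ (2 * n) \<le> e" .
  \<comment> \<open>These words are too short to have disjoint ends of length \<open>n\<close>;
    there are none from length \<open>2 * n\<close> on, so their density is
    \<open>0\<close>.\<close>
  define B where "B = {w :: 'a list. length w < 2 * n}"
  define d' where "d' = real (card P) / c ^ (2 * n)"
  have lim: "density_seq K \<longlonglongrightarrow> d" "density_seq (frame_lang P) \<longlonglongrightarrow> d'"
    "density_seq (frame_lang Q) \<longlonglongrightarrow> real (card Q) / c ^ (2 * n)" "density_seq B \<longlonglongrightarrow> 0"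
  proof -
    show "density_seq B \<longlonglongrightarrow> 0"
    proof (rule density_seq_tendsto)
      fix k assume "2 * n \<le> k"
      then have "B \<inter> words_of_length k = {}" by (auto simp: B_def words_of_length_def)
      then show "real (card (B \<inter> words_of_length k))
        = 0 * real (card (words_of_length k :: 'a list set))" by simp
    qed
  qed (use d lang_density_frame_lang sub in \<open>simp_all add: lang_density_eq_Some_iff W_def c_def d'_def\<close>)
  have "K \<subseteq> frame_lang P \<union> (frame_lang Q \<union> B)"
  proof
    fix w assume w: "w \<in> K"
    show "w \<in> frame_lang P \<union> (frame_lang Q \<union> B)"
    proof (cases "length w < 2 * n")
      case False
      define u x v where "u = take n w" and "x = take (length w - 2 * n) (drop n w)"
        and "v = drop (length w - n) w"
      \<comment> \<open>\<open>drop n w\<close> has \<open>length w - n\<close> letters, so removing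
        the middle part leaves exactly the last \<open>n\<close>.\<close>
      have "drop (length w - 2 * n) (drop n w) = v"
        using False by (simp add: v_def)
      then have weq: "w = u @ x @ v"
        unfolding u_def x_def by (metis append_take_drop_id)
      have "(u, v) \<in> W \<times> W"
        using False by (simp add: W_def words_of_length_def u_def v_def)
      then have "(u, v) \<in> P \<or> (u, v) \<in> Q"
        using w weq by (auto simp: P_def Q_def W_def avoiding_def)
      then show ?thesis unfolding frame_lang_def weq by blast
    qed (simp add: B_def)
  qed
  then have "density_seq K m
      \<le> density_seq (frame_lang P) m + (density_seq (frame_lang Q) m + density_seq B m)" for m
    using density_seq_mono[of K "frame_lang P \<union> (frame_lang Q \<union> B)" m]
      density_seq_Un_le[of "frame_lang P" "frame_lang Q \<union> B" m]
      density_seq_Un_le[of "frame_lang Q" B m] by linarith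
  then have "d \<le> d' + (real (card Q) / c ^ (2 * n) + 0)"
    by (intro LIMSEQ_le[OF lim(1) tendsto_add[OF lim(2) tendsto_add[OF lim(3,4)]]]) auto
  then have "d - e \<le> d'" using Qe by simp
  moreover have "frame_lang P \<subseteq> K" by (auto simp: frame_lang_def P_def intro: z)
  moreover have "frame_lang P \<in> gen_definite"
    using finite_subset[OF sub(1)] W(1) by (intro gen_definite_frame_lang) simp
  ultimately show ?thesis using lim(2) by (auto simp: lang_density_eq_Some_iff)
qed

text \<open>Complementation preserves both families and turns density \<open>d\<close> into
  \<open>1 - d\<close>, so an inner approximation of \<open>- K\<close> is an outer one of
  \<open>K\<close>.\<close>

lemma star_free_outer_approx:
  fixes K :: "'a::finite list set"
  assumes K: "K \<in> star_free" and d: "lang_density K = Some d" and e: "e > 0"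
  shows "\<exists>K'\<in>gen_definite. K \<subseteq> K' \<and> (\<exists>d'. lang_density K' = Some d' \<and> d' \<le> d + e)"
proof -
  obtain K' d' where K': "K' \<in> gen_definite" "K' \<subseteq> - K" "lang_density K' = Some d'"
    "(1 - d) - e \<le> d'"
    using star_free_inner_approx[OF star_free_Compl[OF K] lang_density_Compl[OF d] e] by blast
  show ?thesis
  proof (intro bexI[of _ "- K'"] conjI exI[of _ "1 - d'"])
    show "lang_density (- K') = Some (1 - d')" by (rule lang_density_Compl[OF K'(3)])
  qed (use K' in \<open>auto intro: gen_definite.compl\<close>)
qed

section \<open>Equality of the lower and upper measures\<close>

lemma lower_measure_star_free:
  fixes L :: "'a::finite list set"
  shows "lower_measure star_free L = lower_measure gen_definite L"
proof -
  define D where "D \<C> = {d. \<exists>K\<in>\<C>. K \<subseteq> L \<and> lang_density K = Some d}" for \<C>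
  have bdd: "bdd_above (D \<C>)" for \<C>
    using lang_density_bounds by (auto simp: D_def intro!: bdd_aboveI[of _ 1])
  have sub: "D gen_definite \<subseteq> D star_free"
    using gen_definite_subset_star_free by (auto simp: D_def)
  \<comment> \<open>A real supremum is well behaved only on nonempty bounded sets; the empty
    language supplies a member.\<close>
  have "0 \<in> D gen_definite"
    using empty_in_gen_definite lang_density_empty by (auto simp: D_def)
  then have ne: "D gen_definite \<noteq> {}" "D star_free \<noteq> {}" using sub by auto
  have "Sup (D star_free) \<le> Sup (D gen_definite)"
  \<comment> \<open>The approximation loses an arbitrary \<open>e > 0\<close>, which
    \<open>field_le_epsilon\<close> absorbs; the approximating language stays inside
    \<open>L\<close> because it is inside \<open>K\<close>.\<close>
  proof (rule cSup_least[OF ne(2)], rule field_le_epsilon)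
    fix d e :: real assume "d \<in> D star_free" "e > 0"
    then obtain K where "K \<in> star_free" "K \<subseteq> L" "lang_density K = Some d"
      by (auto simp: D_def)
    moreover from star_free_inner_approx[OF this(1,3) \<open>e > 0\<close>] obtain K' d'
      where "K' \<in> gen_definite" "K' \<subseteq> K" "lang_density K' = Some d'" "d - e \<le> d'" by auto
    ultimately have "d' \<in> D gen_definite" "d - e \<le> d'" by (auto simp: D_def)
    then show "d \<le> Sup (D gen_definite) + e" using cSup_upper[OF _ bdd] by fastforce
  qed
  then show ?thesis
    using cSup_subset_mono[OF ne(1) bdd sub] by (simp add: lower_measure_def D_def)
qed

lemma upper_measure_star_free:
  fixes L :: "'a::finite list set"
  shows "upper_measure star_free L = upper_measure gen_definite L"
proof -
  define D where "D \<C> = {d. \<exists>K\<in>\<C>. L \<subseteq> K \<and> lang_density K = Some d}" for \<C>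
  have bdd: "bdd_below (D \<C>)" for \<C>
    using lang_density_bounds by (auto simp: D_def intro!: bdd_belowI[of _ 0])
  have sub: "D gen_definite \<subseteq> D star_free"
    using gen_definite_subset_star_free by (auto simp: D_def)
  \<comment> \<open>Dually, the full language lies above every \<open>L\<close> and makes the
    infimum meaningful.\<close>
  have "1 \<in> D gen_definite"
    using UNIV_in_gen_definite lang_density_UNIV by (auto simp: D_def)
  then have ne: "D gen_definite \<noteq> {}" "D star_free \<noteq> {}" using sub by auto
  have "Inf (D gen_definite) \<le> Inf (D star_free)"
  proof (rule cInf_greatest[OF ne(2)], rule field_le_epsilon)
    fix d e :: real assume "d \<in> D star_free" "e > 0"
    then obtain K where "K \<in> star_free" "L \<subseteq> K" "lang_density K = Some d"
      by (auto simp: D_def)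
    moreover from star_free_outer_approx[OF this(1,3) \<open>e > 0\<close>] obtain K' d'
      where "K' \<in> gen_definite" "K \<subseteq> K'" "lang_density K' = Some d'" "d' \<le> d + e" by auto
    ultimately have "d' \<in> D gen_definite" "d' \<le> d + e" by (auto simp: D_def)
    then show "Inf (D gen_definite) \<le> d + e" using cInf_lower[OF _ bdd] by fastforce
  qed
  then show ?thesis
    using cInf_superset_mono[OF ne(1) bdd sub] by (simp add: upper_measure_def D_def)
qed

theorem theorem13:
  assumes "card (UNIV :: 'a::finite set) \<ge> 2"
  shows "Ext (star_free :: 'a list set set) = Ext gen_definite"
  by (simp add: Ext_def measurable_lang_def lower_measure_star_free upper_measure_star_free)

end
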